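(* Let $X$ be a Tychonoff space and let $A$ be a closed subset of $X$. Then the following three conditions are equivalent. (1) $A$ is Lindelöf and $C$-embedded in $X$. (2) For every compact subset $K$ of $\mathrm{cl}_{\beta X}A\setminus A$ there is a zero-set $Z$ of $\beta X$ such that $K\subseteq Z\subseteq \beta X\setminus X$. (3) For every compact subset $K$ of $\mathrm{cl}_{\beta X}A\setminus A$ there is a countable family $\mathcal{Z}$ of zero-sets of $\beta X$ such that $K\subseteq\bigcup\mathcal{Z}\subseteq\beta X\setminus X$.
   Context: $\beta X$ denotes the Čech–Stone compactification of the Tychonoff space $X$, with $X$ regarded as a subspace of $\beta X$, and $\mathrm{cl}_{\beta X}A$ is the closure of $A$ in $\beta X$. A subspace $A$ of $X$ is $C$-embedded in $X$ if every continuous function from $A$ to $\mathbb{R}$ admits a continuous extension to $X$. A zero-set of a space $Y$ is a set of the form $\{y\in Y: g(y)=0\}$ for some continuous $g:Y\to\mathbb{R}$. *)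

theory Defs
  imports "HOL-Analysis.Analysis"
begin

section \<open>Tychonoff spaces, \<open>C\<close>-embedded subsets and zero-sets\<close>

definition tychonoff_space :: "'a topology \<Rightarrow> bool" where
  "tychonoff_space X \<longleftrightarrow> completely_regular_space X \<and> Hausdorff_space X"

definition C_embedded_in :: "'a topology \<Rightarrow> 'a set \<Rightarrow> bool" where
  "C_embedded_in X A \<longleftrightarrow> A \<subseteq> topspace X \<and>
     (\<forall>f. continuous_map (subtopology X A) euclideanreal f \<longrightarrow>
        (\<exists>g. continuous_map X euclideanreal g \<and> (\<forall>x\<in>A. g x = f x)))"

definition zero_set_of :: "'a topology \<Rightarrow> 'a set \<Rightarrow> bool" where
  "zero_set_of Y Z \<longleftrightarrow>
     (\<exists>g. continuous_map Y euclideanreal g \<and> Z = {y \<in> topspace Y. g y = 0})"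


section \<open>The Cech--Stone compactification\<close>

text \<open>
  \<open>\<beta>X\<close> is the closure of the image of \<open>X\<close> in the cube \<open>[0,1]\<^sup>C\<close>, where \<open>C = C(X,[0,1])\<close>,
  under the evaluation map. A continuous function on \<open>X\<close> is represented by the
  HOL function that is \<open>undefined\<close> outside \<open>topspace X\<close>, so that distinct
  elements of \<open>unit_maps X\<close> are distinct functions on \<open>X\<close>.
\<close>

definition unit_maps :: "'a topology \<Rightarrow> ('a \<Rightarrow> real) set" where
  "unit_maps X = {f \<in> extensional (topspace X). continuous_map X (top_of_set {0..1}) f}"

definition unit_cube :: "'a topology \<Rightarrow> (('a \<Rightarrow> real) \<Rightarrow> real) topology" where
  "unit_cube X = product_topology (\<lambda>f. top_of_set {0..1}) (unit_maps X)"

definition beta_emb :: "'a topology \<Rightarrow> 'a \<Rightarrow> ('a \<Rightarrow> real) \<Rightarrow> real" where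
  "beta_emb X x = (\<lambda>f\<in>unit_maps X. f x)"

definition beta :: "'a topology \<Rightarrow> (('a \<Rightarrow> real) \<Rightarrow> real) topology" where
  "beta X = subtopology (unit_cube X) (unit_cube X closure_of (beta_emb X ` topspace X))"

text \<open>
  The following facts confirm that \<open>beta X\<close>, with \<open>X\<close> regarded as a subspace via
  \<open>beta_emb X\<close>, has the defining properties of the Cech--Stone compactification.
\<close>

lemma compact_space_unit_cube: "compact_space (unit_cube X)"
  unfolding unit_cube_def
  by (simp add: compact_space_product_topology compact_space_subtopology)

lemma Hausdorff_space_unit_cube: "Hausdorff_space (unit_cube X)"
  unfolding unit_cube_def
  by (simp add: Hausdorff_space_product_topology Hausdorff_space_subtopology)

lemma compact_space_beta: "compact_space (beta X)"
  unfolding beta_def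
  by (simp add: closedin_compact_space compact_space_subtopology compact_space_unit_cube)

lemma Hausdorff_space_beta: "Hausdorff_space (beta X)"
  unfolding beta_def by (simp add: Hausdorff_space_subtopology Hausdorff_space_unit_cube)

lemma continuous_map_beta_emb_cube: "continuous_map X (unit_cube X) (beta_emb X)"
  unfolding unit_cube_def beta_emb_def
  by (auto simp: continuous_map_componentwise unit_maps_def)

lemma beta_emb_image: "beta_emb X ` topspace X \<subseteq> topspace (unit_cube X)"
  using continuous_map_image_subset_topspace[OF continuous_map_beta_emb_cube] .

lemma topspace_beta: "topspace (beta X) = unit_cube X closure_of (beta_emb X ` topspace X)"
  unfolding beta_def by (simp add: closure_of_subset_topspace inf_absorb2)

lemma beta_emb_dense: "beta X closure_of (beta_emb X ` topspace X) = topspace (beta X)"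
  unfolding topspace_beta unfolding beta_def
  by (simp add: closure_of_subtopology closure_of_subset beta_emb_image Int_absorb1)

lemma embedding_map_beta_emb:
  assumes "tychonoff_space X"
  shows "embedding_map X (beta X) (beta_emb X)"
proof -
  have bdd: "bounded (f ` topspace X)" if "f \<in> topspace X \<rightarrow> {0..1::real}" for f
    by (rule bounded_subset[of "{0..1}"]) (use that in auto)
  have eq: "mspace (submetric (cfunspace X euclidean_metric) {f. f \<in> topspace X \<rightarrow> {0..1}})
      = unit_maps X"
    unfolding unit_maps_def by (auto simp: continuous_map_in_subtopology bdd Pi_iff)
  have "embedding_map X (unit_cube X) (beta_emb X)"
    using completely_regular_space_cube_embedding_explicit[of X] assms
    unfolding eq tychonoff_space_def unit_cube_def beta_emb_def by blast
  then show ?thesis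
    unfolding beta_def
    by (simp add: embedding_map_in_subtopology closure_of_subset beta_emb_image)
qed

lemma beta_extension:
  fixes X :: "'a topology" and Y :: "'b topology"
  assumes Y: "compact_space Y" "Hausdorff_space Y" and f: "continuous_map X Y f"
  shows "\<exists>F. continuous_map (beta X) Y F \<and> (\<forall>x\<in>topspace X. F (beta_emb X x) = f x)"
proof -
  define T where "T = (\<lambda>p :: ('a \<Rightarrow> real) \<Rightarrow> real. \<lambda>g\<in>unit_maps Y. p (restrict (g \<circ> f) (topspace X)))"
  have comp: "restrict (g \<circ> f) (topspace X) \<in> unit_maps X" if "g \<in> unit_maps Y" for g
  proof -
    have "continuous_map X (top_of_set {0..1}) (g \<circ> f)"
      using that f by (auto simp: unit_maps_def intro: continuous_map_compose)
    then have "continuous_map X (top_of_set {0..1}) (restrict (g \<circ> f) (topspace X))"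
      by (rule continuous_map_eq) auto
    then show ?thesis by (auto simp: unit_maps_def)
  qed
  have T: "continuous_map (unit_cube X) (unit_cube Y) T"
    unfolding unit_cube_def T_def continuous_map_componentwise
    using comp by (auto intro: continuous_map_product_projection)
  have Te: "T (beta_emb X x) = beta_emb Y (f x)" if "x \<in> topspace X" for x
    unfolding T_def beta_emb_def using that comp by (auto simp: restrict_def)
  have tY: "tychonoff_space Y"
    using Y by (simp add: tychonoff_space_def compact_Hausdorff_or_regular_imp_normal_space
        normal_imp_completely_regular_space_gen Hausdorff_imp_t1_space)
  have "closedin (unit_cube Y) (beta_emb Y ` topspace Y)"
    using Y(1) continuous_map_beta_emb_cube[of Y] Hausdorff_space_unit_cube
    by (metis compact_space_def image_compactin compactin_imp_closedin)
  then have clY: "unit_cube Y closure_of (beta_emb Y ` topspace Y) = beta_emb Y ` topspace Y"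
    by (rule closure_of_closedin)
  have bY: "beta Y = subtopology (unit_cube Y) (beta_emb Y ` topspace Y)"
    unfolding beta_def clY ..
  have "T ` (unit_cube X closure_of (beta_emb X ` topspace X))
      \<subseteq> unit_cube Y closure_of (T ` beta_emb X ` topspace X)"
    using T by (simp add: continuous_map_image_closure_subset)
  also have "\<dots> \<subseteq> unit_cube Y closure_of (beta_emb Y ` topspace Y)"
    by (rule closure_of_mono) (use Te f in \<open>auto simp: continuous_map_def\<close>)
  finally have im: "T ` topspace (beta X) \<subseteq> beta_emb Y ` topspace Y"
    by (simp add: topspace_beta clY)
  have Tb: "continuous_map (beta X) (beta Y) T"
    unfolding bY continuous_map_in_subtopology
    using T im by (auto simp: beta_def continuous_map_from_subtopology)
  have "homeomorphic_map Y (beta Y) (beta_emb Y)"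
    using embedding_map_beta_emb[OF tY] unfolding embedding_map_def bY
    by (simp add: subtopology_subtopology)
  then obtain h where h: "homeomorphic_maps Y (beta Y) (beta_emb Y) h"
    by (auto simp: homeomorphic_map_maps)
  have "continuous_map (beta X) Y (h \<circ> T)"
    using Tb h by (auto simp: homeomorphic_maps_def intro: continuous_map_compose)
  moreover have "(h \<circ> T) (beta_emb X x) = f x" if "x \<in> topspace X" for x
    using that Te h f by (auto simp: homeomorphic_maps_def continuous_map_def)
  ultimately show ?thesis by blast
qed

end

theory Submission
  imports Defs
begin

text \<open>
  Write \<open>Y\<close> for \<open>\<beta>X\<close> and \<open>cl A\<close> for the closure of \<open>A\<close> in \<open>Y\<close>. The proof goes round the
  cycle (1), (2), (3), (1), where the step from (2) to (3) is trivial.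

  From (1) to (2). Let \<open>K\<close> be compact in \<open>cl A - A\<close>. Since \<open>A\<close> is Lindelof, countably many cozero-sets
  of \<open>Y\<close> that miss \<open>K\<close> cover \<open>A\<close>, and so some continuous \<open>g\<close> on \<open>Y\<close> vanishes on \<open>K\<close> and
  nowhere on \<open>A\<close> (\<open>zero_set_separating_compact_Lindelof\<close>). Its zero-set may still meet \<open>X\<close> outside
  \<open>A\<close>. Here \<open>C\<close>-embedding enters: \<open>1/g\<close> extends from \<open>A\<close> to a real function \<open>h\<close> on \<open>X\<close>; the function
  \<open>1 / max 1 \<bar>h\<bar>\<close> is bounded and positive on all of \<open>X\<close>, and its extension to \<open>Y\<close> agrees
  with \<open>min 1 \<bar>g\<bar>\<close> on \<open>cl A\<close>, hence vanishes on \<open>K\<close> (\<open>zero_set_missing_space\<close>).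

  From (3) to (1). The complement of a zero-set is sigma-compact, and a countable intersection of
  sigma-compact subsets of a compact space is Lindelof (\<open>Lindelof_space_Inter_fsigma\<close>). So let \<open>G\<close>
  be any \<open>G\<^sub>\<delta>\<close>-set of \<open>Y\<close> that contains \<open>A\<close>. Then \<open>cl A - G\<close> is a countable union of compact subsets of
  \<open>cl A - A\<close>, so by (3) countably many zero-sets that miss \<open>X\<close> cover it; what is left of
  \<open>Y\<close> is a Lindelof space \<open>L\<close> with \<open>X \<subseteq> L\<close> and \<open>L \<inter> cl A \<subseteq> G\<close>
  (\<open>Lindelof_superset_within_gdelta\<close>). Two choices of \<open>G\<close> give the two parts of (1).
  If \<open>G\<close> is the union of an open cover of \<open>A\<close>, then that cover also covers the Lindelof space
  \<open>L \<inter> cl A\<close>, and a countable part of it suffices. If \<open>G\<close> is a \<open>G\<^sub>\<delta>\<close>-set to which Lavrentiev's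
  theorem extends a given continuous function on \<open>A\<close>, in the sense that the extension lives on
  \<open>cl A \<inter> G\<close>, then this function is defined on the closed subset \<open>L \<inter> cl A\<close> of the
  normal space \<open>L\<close>, and Tietze's theorem extends it to \<open>L\<close>, hence to \<open>X\<close>.
\<close>

section \<open>Countable intersections of sigma-compact sets\<close>

text \<open>
  Call a set small if countably many members of the given cover contain its part in the
  intersection \<open>L\<close>. If the whole space were large, one could choose inside it successively one large
  closed piece of each sigma-compact set. The pieces shrink to a closed set that lies in \<open>L\<close> and is
  therefore covered; by compactness finitely many members of the cover already contain one of
  the pieces, which is then small.
\<close>
lemma Lindelof_space_Inter_fsigma:
  assumes Y: "compact_space Y" and "countable \<B>"
    and fsigma: "\<And>B. B \<in> \<B> \<Longrightarrow> fsigma_in Y B"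
  shows "Lindelof_space (subtopology Y (\<Inter>\<B>))"
proof (cases "\<B> = {}")
  case True
  with Y show ?thesis by (simp add: compact_imp_Lindelof_space)
next
  case False
  define B where "B = from_nat_into \<B>"
  have rangeB: "range B = \<B>"
    using False \<open>countable \<B>\<close> by (simp add: B_def)
  have "\<forall>n. \<exists>C::nat \<Rightarrow> 'a set. (\<forall>m. closedin Y (C m)) \<and> \<Union>(range C) = B n"
    using fsigma rangeB fsigma_in_ascending by (metis rangeI)
  from choice[OF this] obtain C :: "nat \<Rightarrow> nat \<Rightarrow> 'a set"
    where C: "\<And>n m. closedin Y (C n m)" and BC: "\<And>n. \<Union>(range (C n)) = B n"
    by blast
  define L where "L = topspace Y \<inter> \<Inter>\<B>"
  show ?thesis
    unfolding Lindelof_space_subtopology L_def[symmetric]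
  proof (intro allI impI, elim conjE)
    fix \<W> assume op: "\<forall>W\<in>\<W>. openin Y W" and cov: "L \<subseteq> \<Union>\<W>"
    define small where "small S \<longleftrightarrow> (\<exists>\<V>. countable \<V> \<and> \<V> \<subseteq> \<W> \<and> L \<inter> S \<subseteq> \<Union>\<V>)" for S
    have split: "\<exists>m. \<not> small (S \<inter> C n m)" if "\<not> small S" for S n
    proof (rule ccontr)
      assume "\<not> ?thesis"
      then obtain \<V> where \<V>: "\<And>m. countable (\<V> m) \<and> \<V> m \<subseteq> \<W> \<and> L \<inter> (S \<inter> C n m) \<subseteq> \<Union>(\<V> m)"
        unfolding small_def by metis
      have "L \<inter> S \<subseteq> (\<Union>m. L \<inter> (S \<inter> C n m))"
        using BC[of n] rangeB by (auto simp: L_def)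
      also have "\<dots> \<subseteq> \<Union>(\<Union>m. \<V> m)"
      proof (rule UN_least)
        show "L \<inter> (S \<inter> C n m) \<subseteq> \<Union>(\<Union>m. \<V> m)" for m
          using \<V>[of m] by (meson Union_mono UN_upper UNIV_I order_trans)
      qed
      finally have "small S"
        unfolding small_def using \<V> by (intro exI[of _ "\<Union>m. \<V> m"]) auto
      with that show False ..
    qed
    have "small (topspace Y)"
    proof (rule ccontr)
      assume large: "\<not> small (topspace Y)"
      have "\<exists>S. \<forall>n. (closedin Y (S n) \<and> \<not> small (S n)) \<and> S (Suc n) \<subseteq> S n \<and> S (Suc n) \<subseteq> B n"
      proof (rule dependent_nat_choice)
        show "\<exists>T. (closedin Y T \<and> \<not> small T) \<and> T \<subseteq> S \<and> T \<subseteq> B n"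
          if "closedin Y S \<and> \<not> small S" for S n
          using split[of S n] that C[of n] BC[of n] by blast
      qed (use large in blast)
      then obtain S where S: "\<And>n. closedin Y (S n)" "\<And>n. \<not> small (S n)"
          "\<And>n. S (Suc n) \<subseteq> S n" "\<And>n. S (Suc n) \<subseteq> B n"
        by blast
      have anti: "S n \<subseteq> S m" if "m \<le> n" for m n
        using that S(3) by (rule lift_Suc_antimono_le[rotated])
      have "\<Inter>(range S) \<subseteq> L"
        using S(1,4) rangeB closedin_subset by (fastforce simp: L_def)
      with cov have "topspace Y \<subseteq> \<Union>(\<W> \<union> range (\<lambda>n. topspace Y - S n))"
        by auto
      moreover have "\<forall>U \<in> \<W> \<union> range (\<lambda>n. topspace Y - S n). openin Y U"
        using op S(1) by auto
      ultimately obtain \<F> where \<F>: "finite \<F>" "\<F> \<subseteq> \<W> \<union> range (\<lambda>n. topspace Y - S n)"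
          "topspace Y \<subseteq> \<Union>\<F>"
        using Y unfolding compact_space_alt by metis
      have "finite (\<F> - \<W>)" "\<F> - \<W> \<subseteq> range (\<lambda>n. topspace Y - S n)"
        using \<F> by auto
      then obtain I where I: "finite I" "\<F> - \<W> = (\<lambda>n. topspace Y - S n) ` I"
        by (meson finite_subset_image)
      obtain N where N: "\<forall>n\<in>I. n \<le> N"
        using \<open>finite I\<close> finite_nat_set_iff_bounded_le by blast
      have "L \<inter> S N \<subseteq> \<Union>(\<F> \<inter> \<W>)"
      proof
        fix x assume x: "x \<in> L \<inter> S N"
        then obtain U where U: "U \<in> \<F>" "x \<in> U"
          using \<F>(3) by (auto simp: L_def)
        have "U \<in> \<W>"
        proof (rule ccontr)
          assume "U \<notin> \<W>"
          with U(1) I(2) obtain n where n: "n \<in> I" "U = topspace Y - S n"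
            by blast
          with N anti[of n N] have "S N \<subseteq> S n"
            by blast
          with x U(2) n(2) show False
            by blast
        qed
        with U show "x \<in> \<Union>(\<F> \<inter> \<W>)"
          by blast
      qed
      with \<F>(1) have "small (S N)"
        unfolding small_def by (intro exI[of _ "\<F> \<inter> \<W>"]) (auto simp: countable_finite)
      with S(2) show False ..
    qed
    then show "\<exists>\<V>. countable \<V> \<and> \<V> \<subseteq> \<W> \<and> L \<subseteq> \<Union>\<V>"
      by (simp add: small_def L_def inf.absorb1 le_infI1)
  qed
qed

section \<open>Zero-sets\<close>

lemma fsigma_in_complement_zero_set:
  assumes "zero_set_of Y Z"
  shows "fsigma_in Y (topspace Y - Z)"
proof -
  obtain g where g: "continuous_map Y euclideanreal g" and Z: "Z = {y \<in> topspace Y. g y = 0}"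
    using assms by (auto simp: zero_set_of_def)
  have "topspace Y - Z = (\<Union>n. {y \<in> topspace Y. g y \<in> {t. inverse (real (Suc n)) \<le> \<bar>t\<bar>}})"
  proof -
    have "\<exists>n. inverse (real (Suc n)) \<le> \<bar>g y\<bar>" if "g y \<noteq> 0" for y
      using reals_Archimedean[of "\<bar>g y\<bar>"] that by (meson less_imp_le zero_less_abs_iff)
    then show ?thesis by (auto simp: Z)
  qed
  moreover have "fsigma_in Y {y \<in> topspace Y. g y \<in> {t. inverse (real (Suc n)) \<le> \<bar>t\<bar>}}" for n
    by (intro closed_imp_fsigma_in closedin_continuous_map_preimage[OF g])
       (simp add: closed_Collect_le continuous_on_rabs)
  ultimately show ?thesis
    by (auto intro!: fsigma_in_Union)
qed

text \<open>
  The functions are combined into one map to the space of real sequences, which is metrizable; the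
  distance from the zero sequence then vanishes exactly where all of them do.
\<close>
lemma zero_set_of_INT:
  fixes Z :: "nat \<Rightarrow> 'a set"
  assumes "\<And>n. zero_set_of Y (Z n)"
  shows "zero_set_of Y (\<Inter>n. Z n)"
proof -
  obtain g where g: "\<And>n. continuous_map Y euclideanreal (g n)"
    and Z: "\<And>n. Z n = {y \<in> topspace Y. g n y = 0}"
    using assms unfolding zero_set_of_def by metis
  have "continuous_map Y euclidean (\<lambda>y n. g n y)"
    using g by (simp add: continuous_map_componentwise_UNIV flip: euclidean_product_topology)
  moreover have "continuous_map euclidean euclideanreal (\<lambda>p. dist p (\<lambda>n::nat. 0::real))"
    by (simp add: continuous_on_dist)
  ultimately have "continuous_map Y euclideanreal ((\<lambda>p. dist p (\<lambda>n. 0)) \<circ> (\<lambda>y n. g n y))"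
    by (rule continuous_map_compose)
  moreover have "(\<Inter>n. Z n) = {y \<in> topspace Y. ((\<lambda>p. dist p (\<lambda>n. 0)) \<circ> (\<lambda>y n. g n y)) y = 0}"
    by (auto simp: Z fun_eq_iff)
  ultimately show ?thesis
    unfolding zero_set_of_def by blast
qed

text \<open>
  Countably many of the cozero-sets that miss \<open>K\<close> cover \<open>S\<close>; the intersection of the complementary
  zero-sets separates \<open>K\<close> from \<open>S\<close>.
\<close>
lemma zero_set_separating_compact_Lindelof:
  assumes Y: "completely_regular_space Y" "Hausdorff_space Y"
    and K: "compactin Y K" and S: "Lindelof_space (subtopology Y S)" "S \<subseteq> topspace Y"
    and "disjnt K S"
  obtains Z where "zero_set_of Y Z" "K \<subseteq> Z" "disjnt Z S"
proof -
  have "\<exists>f. continuous_map Y euclideanreal f \<and> f s = 1 \<and> f ` K \<subseteq> {0}" if "s \<in> S" for s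
  proof -
    have "closedin Y K" "s \<in> topspace Y - K"
      using compactin_imp_closedin[OF Y(2) K] that S(2) \<open>disjnt K S\<close> by (auto simp: disjnt_iff)
    then show ?thesis
      using Y(1) completely_regular_space_gen_alt[of "1::real" 0 Y] by simp
  qed
  then obtain f where f: "\<And>s. s \<in> S \<Longrightarrow> continuous_map Y euclideanreal (f s)"
      "\<And>s. s \<in> S \<Longrightarrow> f s s = 1" "\<And>s. s \<in> S \<Longrightarrow> f s ` K \<subseteq> {0}"
    by metis
  define U where "U s = {y \<in> topspace Y. f s y \<in> - {0}}" for s
  have "openin Y (U s)" if "s \<in> S" for s
    unfolding U_def by (rule openin_continuous_map_preimage[OF f(1)[OF that]]) auto
  moreover have "S \<subseteq> \<Union>(U ` S)"
    using f(2) S(2) by (auto simp: U_def)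
  ultimately obtain \<V> where \<V>: "countable \<V>" "\<V> \<subseteq> U ` S" "S \<subseteq> \<Union>\<V>"
    using S(1) unfolding Lindelof_space_subtopology_subset[OF S(2)]
    by (metis (no_types, lifting) imageE)
  then obtain I where I: "countable I" "I \<subseteq> S" "\<V> = U ` I"
    by (meson countable_subset_image)
  show thesis
  proof (cases "I = {}")
    case True
    then have "S = {}" using \<V>(3) I(3) by auto
    moreover have "zero_set_of Y (topspace Y)"
      unfolding zero_set_of_def by (rule exI[of _ "\<lambda>_. 0"]) auto
    ultimately show ?thesis
      using that compactin_subset_topspace[OF K] by simp
  next
    case False
    define i where "i = from_nat_into I"
    have i: "range i = I"
      using False I(1) by (simp add: i_def)
    define Z where "Z n = {y \<in> topspace Y. f (i n) y = 0}" for n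
    show ?thesis
    proof
      show "zero_set_of Y (\<Inter>n. Z n)"
        unfolding zero_set_of_def Z_def
      proof (intro zero_set_of_INT[unfolded zero_set_of_def] exI conjI)
        show "continuous_map Y euclideanreal (f (i n))" for n
          using f(1) i I(2) by blast
      qed simp
      show "K \<subseteq> (\<Inter>n. Z n)"
        using f(3) i I(2) compactin_subset_topspace[OF K] by (fastforce simp: Z_def)
      show "disjnt (\<Inter>n. Z n) S"
        using \<V>(3) unfolding I(3) i[symmetric] by (force simp: disjnt_iff Z_def U_def)
    qed
  qed
qed

section \<open>Subsets whose remainder is covered by zero-sets\<close>

text \<open>
  \<open>L\<close> is the complement of countably many zero-sets that cover \<open>C - G\<close> and miss \<open>T\<close>.
  They exist because \<open>C - G\<close> is sigma-compact: the hypothesis applies to each of its compact pieces.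
\<close>
lemma Lindelof_superset_within_gdelta:
  assumes Y: "compact_space Y" and C: "closedin Y C" and G: "gdelta_in Y G" "S \<subseteq> G"
    and T: "T \<subseteq> topspace Y"
    and cover: "\<And>K. compactin Y K \<Longrightarrow> K \<subseteq> C - S \<Longrightarrow>
      \<exists>\<Z>. countable \<Z> \<and> (\<forall>Z\<in>\<Z>. zero_set_of Y Z) \<and> K \<subseteq> \<Union>\<Z> \<and> \<Union>\<Z> \<subseteq> topspace Y - T"
  obtains L where "T \<subseteq> L" "L \<subseteq> topspace Y" "L \<inter> C \<subseteq> G" "Lindelof_space (subtopology Y L)"
proof -
  obtain D :: "nat \<Rightarrow> 'a set" where D: "\<And>n. closedin Y (D n)" "\<Union>(range D) = topspace Y - G"
    using G(1) unfolding gdelta_in_fsigma_in fsigma_in_ascending by blast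
  have compact: "compactin Y (C \<inter> D n)" for n
    using Y C D(1) by (simp add: closedin_compact_space closedin_Int)
  have subset: "C \<inter> D n \<subseteq> C - S" for n
    using D(2) G(2) by blast
  have "\<forall>n. \<exists>\<Z>. countable \<Z> \<and> (\<forall>Z\<in>\<Z>. zero_set_of Y Z) \<and> C \<inter> D n \<subseteq> \<Union>\<Z>
      \<and> \<Union>\<Z> \<subseteq> topspace Y - T"
    using cover[OF compact subset] ..
  from choice[OF this] obtain \<Z>
    where *: "\<forall>n. countable (\<Z> n) \<and> (\<forall>Z\<in>\<Z> n. zero_set_of Y Z) \<and> C \<inter> D n \<subseteq> \<Union>(\<Z> n)
      \<and> \<Union>(\<Z> n) \<subseteq> topspace Y - T" ..
  have \<Z>: "countable (\<Z> n)" "Z \<in> \<Z> n \<Longrightarrow> zero_set_of Y Z"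
      "C \<inter> D n \<subseteq> \<Union>(\<Z> n)" "\<Union>(\<Z> n) \<subseteq> topspace Y - T" for n Z
    using spec[OF *, of n] by simp_all
  \<comment> \<open>The whole space is added so that the intersection lies in it even if there are no zero-sets.\<close>
  define \<B> where "\<B> = insert (topspace Y) ((\<lambda>Z. topspace Y - Z) ` (\<Union>n. \<Z> n))"
  show thesis
  proof
    show "T \<subseteq> \<Inter>\<B>"
      using T \<Z>(4) by (fastforce simp: \<B>_def)
    show "\<Inter>\<B> \<subseteq> topspace Y"
      by (auto simp: \<B>_def)
    show "\<Inter>\<B> \<inter> C \<subseteq> G"
    proof
      fix y assume y: "y \<in> \<Inter>\<B> \<inter> C"
      show "y \<in> G"
      proof (rule ccontr)
        assume "y \<notin> G"
        then obtain n where "y \<in> C \<inter> D n"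
          using y D(2) by (auto simp: \<B>_def)
        then obtain Z where "Z \<in> \<Z> n" "y \<in> Z"
          using \<Z>(3) by blast
        then have "topspace Y - Z \<in> \<B>"
          by (auto simp: \<B>_def)
        with y \<open>y \<in> Z\<close> show False
          by blast
      qed
    qed
    show "Lindelof_space (subtopology Y (\<Inter>\<B>))"
      using Y \<Z>(1,2)
      by (intro Lindelof_space_Inter_fsigma) (auto simp: \<B>_def fsigma_in_complement_zero_set)
  qed
qed

lemma Lindelof_space_if_zero_set_covers:
  assumes Y: "compact_space Y" and T: "S \<subseteq> T" "T \<subseteq> topspace Y"
    and cover: "\<And>K. compactin Y K \<Longrightarrow> K \<subseteq> Y closure_of S - S \<Longrightarrow>
      \<exists>\<Z>. countable \<Z> \<and> (\<forall>Z\<in>\<Z>. zero_set_of Y Z) \<and> K \<subseteq> \<Union>\<Z> \<and> \<Union>\<Z> \<subseteq> topspace Y - T"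
  shows "Lindelof_space (subtopology Y S)"
proof -
  have S: "S \<subseteq> topspace Y" using T by blast
  show ?thesis
    unfolding Lindelof_space_subtopology_subset[OF S]
  proof (intro allI impI, elim conjE)
    fix \<U> assume \<U>: "\<forall>U\<in>\<U>. openin Y U" "S \<subseteq> \<Union>\<U>"
    have "gdelta_in Y (\<Union>\<U>)"
      using \<U>(1) by (intro open_imp_gdelta_in) auto
    then obtain L where L: "T \<subseteq> L" "L \<subseteq> topspace Y" "L \<inter> Y closure_of S \<subseteq> \<Union>\<U>"
        "Lindelof_space (subtopology Y L)"
      using Lindelof_superset_within_gdelta[OF Y closedin_closure_of _ \<U>(2) T(2) cover] by blast
    have "closedin (subtopology Y L) (L \<inter> Y closure_of S)"
      by (simp add: closedin_subtopology_Int_closed)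
    then have Lin: "Lindelof_space (subtopology Y (L \<inter> Y closure_of S))"
      using Lindelof_space_closedin_subtopology[OF L(4)] by (fastforce simp: subtopology_subtopology)
    have "L \<inter> Y closure_of S \<subseteq> topspace Y"
      using L(2) by blast
    from spec[OF iffD1[OF Lindelof_space_subtopology_subset[OF this] Lin], of \<U>, THEN mp]
    obtain \<V> where "countable \<V>" "\<V> \<subseteq> \<U>" "L \<inter> Y closure_of S \<subseteq> \<Union>\<V>"
      using \<U>(1) L(3) by blast
    moreover have "S \<subseteq> L \<inter> Y closure_of S"
      using L(1) T closure_of_subset[OF S] by blast
    ultimately show "\<exists>\<V>. countable \<V> \<and> \<V> \<subseteq> \<U> \<and> S \<subseteq> \<Union>\<V>"
      by blast
  qed
qed

text \<open>
  A continuous function on \<open>S\<close> extends in two steps: by Lavrentiev's theorem to the part of the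
  closure of \<open>S\<close> in a \<open>G\<^sub>\<delta>\<close>-set, and from there by Tietze's theorem to a Lindelof,
  hence normal, space that contains \<open>T\<close>. Unbounded functions need no separate treatment, since
  points near which the function is unbounded simply stay outside the \<open>G\<^sub>\<delta>\<close>-set.
\<close>
lemma C_embedded_if_zero_set_covers:
  assumes Y: "compact_space Y" "Hausdorff_space Y" and T: "S \<subseteq> T" "T \<subseteq> topspace Y"
    and cover: "\<And>K. compactin Y K \<Longrightarrow> K \<subseteq> Y closure_of S - S \<Longrightarrow>
      \<exists>\<Z>. countable \<Z> \<and> (\<forall>Z\<in>\<Z>. zero_set_of Y Z) \<and> K \<subseteq> \<Union>\<Z> \<and> \<Union>\<Z> \<subseteq> topspace Y - T"
  shows "C_embedded_in (subtopology Y T) S"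
  unfolding C_embedded_in_def
proof (intro conjI allI impI)
  have S: "S \<subseteq> topspace Y" using T by blast
  show "S \<subseteq> topspace (subtopology Y T)" using S T by auto
  fix f assume "continuous_map (subtopology (subtopology Y T) S) euclideanreal f"
  then have "continuous_map (subtopology Y S) euclideanreal f"
    using T(1) by (simp add: subtopology_subtopology inf.absorb2)
  then obtain G g where G: "gdelta_in Y G" "S \<subseteq> G"
      and g: "continuous_map (subtopology Y (Y closure_of S \<inter> G)) euclideanreal g"
             "\<And>x. x \<in> S \<Longrightarrow> g x = f x"
    using Lavrentiev_extension_gen[OF S completely_metrizable_space_euclidean] by metis
  obtain L where L: "T \<subseteq> L" "L \<subseteq> topspace Y" "L \<inter> Y closure_of S \<subseteq> G"
      "Lindelof_space (subtopology Y L)"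
    using Lindelof_superset_within_gdelta[OF Y(1) closedin_closure_of G T(2) cover] by blast
  have "regular_space Y"
    using Y by (simp add: compact_Hausdorff_imp_regular_space)
  then have "normal_space (subtopology Y L)"
    using L(4) by (simp add: regular_Lindelof_imp_normal_space regular_space_subtopology)
  moreover have "closedin (subtopology Y L) (L \<inter> Y closure_of S)"
    by (simp add: closedin_subtopology_Int_closed)
  moreover have "continuous_map (subtopology (subtopology Y L) (L \<inter> Y closure_of S)) euclideanreal g"
    using continuous_map_from_subtopology_mono[OF g(1)] L(3)
    by (simp add: subtopology_subtopology)
  ultimately obtain u where u: "continuous_map (subtopology Y L) euclideanreal u"
      "\<forall>x \<in> L \<inter> Y closure_of S. u x = g x"
    by (metis normal_space_iff_Tietze)
  have "S \<subseteq> L \<inter> Y closure_of S"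
    using L(1) T closure_of_subset[OF S] by blast
  with u(2) g(2) have "\<forall>x\<in>S. u x = f x"
    by (metis subsetD)
  with continuous_map_from_subtopology_mono[OF u(1) L(1)]
  show "\<exists>g. continuous_map (subtopology Y T) euclideanreal g \<and> (\<forall>x\<in>S. g x = f x)"
    by blast
qed

section \<open>Homeomorphic images and the Cech--Stone extension\<close>

lemma C_embedded_in_if_homeomorphic_image:
  assumes hom: "homeomorphic_map X Y e" and A: "A \<subseteq> topspace X"
    and emb: "C_embedded_in Y (e ` A)"
  shows "C_embedded_in X A"
  unfolding C_embedded_in_def
proof (intro conjI allI impI A)
  obtain h where h: "homeomorphic_maps X Y e h"
    using hom homeomorphic_map_maps by blast
  have he: "h (e x) = x" if "x \<in> topspace X" for x
    using h that by (simp add: homeomorphic_maps_def)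
  fix f assume f: "continuous_map (subtopology X A) euclideanreal f"
  have "continuous_map (subtopology Y (e ` A)) X h"
    using h by (simp add: homeomorphic_maps_def continuous_map_from_subtopology)
  then have "continuous_map (subtopology Y (e ` A)) (subtopology X A) h"
    using he A by (auto simp: continuous_map_in_subtopology)
  then have "continuous_map (subtopology Y (e ` A)) euclideanreal (f \<circ> h)"
    using f by (rule continuous_map_compose)
  then obtain g where g: "continuous_map Y euclideanreal g" "\<forall>y \<in> e ` A. g y = (f \<circ> h) y"
    using emb unfolding C_embedded_in_def by blast
  have "continuous_map X euclideanreal (g \<circ> e)"
    using h g(1) by (auto simp: homeomorphic_maps_def intro: continuous_map_compose)
  moreover have "\<forall>x\<in>A. (g \<circ> e) x = f x"
    using g(2) he A by auto
  ultimately show "\<exists>g. continuous_map X euclideanreal g \<and> (\<forall>x\<in>A. g x = f x)"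
    by blast
qed

text \<open>
  \<open>C\<close>-embedding turns a zero-set that misses \<open>A\<close> into one that misses all of \<open>X\<close> and still contains
  \<open>K\<close>: the reciprocal of the defining function is extended from \<open>A\<close> to \<open>X\<close> as a finite function,
  so that its reciprocal cannot vanish on \<open>X\<close>.
\<close>
lemma zero_set_missing_space:
  assumes emb: "C_embedded_in X A"
    and K: "K \<subseteq> beta X closure_of (beta_emb X ` A)"
    and Z: "zero_set_of (beta X) Z" "K \<subseteq> Z" "disjnt Z (beta_emb X ` A)"
  obtains Z' where "zero_set_of (beta X) Z'" "K \<subseteq> Z'"
    "Z' \<subseteq> topspace (beta X) - beta_emb X ` topspace X"
proof -
  obtain g where g: "continuous_map (beta X) euclideanreal g"
    and Zg: "Z = {y \<in> topspace (beta X). g y = 0}"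
    using Z(1) by (auto simp: zero_set_of_def)
  have A: "A \<subseteq> topspace X"
    using emb by (simp add: C_embedded_in_def)
  have e: "continuous_map X (beta X) (beta_emb X)"
    unfolding beta_def
    by (simp add: continuous_map_in_subtopology continuous_map_beta_emb_cube closure_of_subset
        beta_emb_image flip: image_subset_iff_funcset)
  have nz: "g (beta_emb X x) \<noteq> 0" if "x \<in> A" for x
    using Z(3) that A continuous_map_image_subset_topspace[OF e] by (auto simp: Zg disjnt_iff)
  have "continuous_map (subtopology X A) euclideanreal (g \<circ> beta_emb X)"
    using continuous_map_compose[OF e g] by (rule continuous_map_from_subtopology)
  then have "continuous_map (subtopology X A) euclideanreal (\<lambda>x. inverse (g (beta_emb X x)))"
    using nz by (intro continuous_map_real_inverse) (auto simp: o_def)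
  then obtain h where h: "continuous_map X euclideanreal h"
      "\<forall>x\<in>A. h x = inverse (g (beta_emb X x))"
    using emb unfolding C_embedded_in_def by blast
  \<comment> \<open>The maximum makes \<open>k\<close> bounded, so that it extends, and avoids the zeros of \<open>h\<close> outside \<open>A\<close>.\<close>
  define k where "k x = inverse (max 1 \<bar>h x\<bar>)" for x
  have "continuous_map X euclideanreal k"
    unfolding k_def using h(1)
    by (intro continuous_map_real_inverse continuous_map_real_max continuous_map_real_abs) auto
  then have "continuous_map X (top_of_set {0..1}) k"
    by (auto simp: continuous_map_in_subtopology k_def field_simps)
  then obtain F where F: "continuous_map (beta X) (top_of_set {0..1}) F"
      "\<forall>x\<in>topspace X. F (beta_emb X x) = k x"
    using beta_extension[of "top_of_set {0..1::real}" X k]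
    by (auto simp: compact_space_subtopology Hausdorff_space_subtopology)
  have contF: "continuous_map (beta X) euclideanreal F"
    using F(1) continuous_map_into_fulltopology by blast
  have Fg: "F y = min 1 \<bar>g y\<bar>" if "y \<in> beta X closure_of (beta_emb X ` A)" for y
  proof (rule forall_in_closure_of_eq[OF that _ contF])
    show "continuous_map (beta X) euclideanreal (\<lambda>y. min 1 \<bar>g y\<bar>)"
      using g by (intro continuous_map_real_min continuous_map_real_abs) auto
    show "F z = min 1 \<bar>g z\<bar>" if "z \<in> beta_emb X ` A" for z
    proof -
      from that obtain x where x: "x \<in> A" "z = beta_emb X x" by blast
      then have "F z = inverse (max 1 (inverse \<bar>g z\<bar>))"
        using F(2) A h(2) by (auto simp: k_def)
      with nz[OF x(1)] show ?thesis
        unfolding x(2)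
        by (cases "\<bar>g (beta_emb X x)\<bar> \<le> 1")
           (auto simp: max_def min_def field_simps split: if_splits)
    qed
  qed auto
  show thesis
  proof
    show "zero_set_of (beta X) {y \<in> topspace (beta X). F y = 0}"
      using contF by (auto simp: zero_set_of_def)
    show "K \<subseteq> {y \<in> topspace (beta X). F y = 0}"
      using K Z(2) by (force simp: Zg Fg)
    show "{y \<in> topspace (beta X). F y = 0} \<subseteq> topspace (beta X) - beta_emb X ` topspace X"
      using F(2) by (auto simp: k_def)
  qed
qed

theorem theorem2p2:
  fixes X :: "'a topology" and A :: "'a set"
  assumes "tychonoff_space X" and "closedin X A"
  shows
    "(Lindelof_space (subtopology X A) \<and> C_embedded_in X A
        \<longleftrightarrow>
      (\<forall>K. compactin (beta X) K \<and>
           K \<subseteq> beta X closure_of (beta_emb X ` A) - beta_emb X ` A \<longrightarrow>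
         (\<exists>Z. zero_set_of (beta X) Z \<and>
              K \<subseteq> Z \<and> Z \<subseteq> topspace (beta X) - beta_emb X ` topspace X)))
   \<and> (Lindelof_space (subtopology X A) \<and> C_embedded_in X A
        \<longleftrightarrow>
      (\<forall>K. compactin (beta X) K \<and>
           K \<subseteq> beta X closure_of (beta_emb X ` A) - beta_emb X ` A \<longrightarrow>
         (\<exists>\<Z>. countable \<Z> \<and> (\<forall>Z\<in>\<Z>. zero_set_of (beta X) Z) \<and>
              K \<subseteq> \<Union>\<Z> \<and> \<Union>\<Z> \<subseteq> topspace (beta X) - beta_emb X ` topspace X)))"
    (is "(?one \<longleftrightarrow> ?two) \<and> (?one \<longleftrightarrow> ?three)")
proof -
  let ?e = "beta_emb X"
  have A: "A \<subseteq> topspace X"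
    using assms(2) by (rule closedin_subset)
  have e: "homeomorphic_map X (subtopology (beta X) (?e ` topspace X)) ?e"
    using embedding_map_beta_emb[OF assms(1)] by (simp add: embedding_map_def)
  have eX: "?e ` topspace X \<subseteq> topspace (beta X)"
    by (simp add: topspace_beta closure_of_subset beta_emb_image)
  have eA: "?e ` A \<subseteq> ?e ` topspace X"
    using A by blast
  have "homeomorphic_map (subtopology X A) (subtopology (subtopology (beta X) (?e ` topspace X)) (?e ` A)) ?e"
    using homeomorphic_map_subtopologies[OF e, of A "?e ` A"] A eX by (simp add: inf.absorb2 image_mono subset_trans)
  then have hA: "subtopology X A homeomorphic_space subtopology (beta X) (?e ` A)"
    using eA by (simp add: subtopology_subtopology inf.absorb2 homeomorphic_map_imp_homeomorphic_space)
  have Lin: "Lindelof_space (subtopology X A) \<longleftrightarrow> Lindelof_space (subtopology (beta X) (?e ` A))"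
    using hA Lindelof_space_continuous_map_image homeomorphic_space homeomorphic_space_sym
      homeomorphic_imp_continuous_map homeomorphic_imp_surjective_map by metis
  have "?two" if "?one"
  proof (intro allI impI, elim conjE)
    fix K assume K: "compactin (beta X) K" "K \<subseteq> beta X closure_of (?e ` A) - ?e ` A"
    have "completely_regular_space (beta X)"
      by (simp add: compact_Hausdorff_or_regular_imp_normal_space compact_space_beta
          Hausdorff_space_beta normal_imp_completely_regular_space_gen Hausdorff_imp_t1_space)
    moreover have "Lindelof_space (subtopology (beta X) (?e ` A))" "?e ` A \<subseteq> topspace (beta X)"
        "disjnt K (?e ` A)"
      using that Lin K(2) eA eX by (auto simp: disjnt_iff)
    ultimately obtain Z where Z: "zero_set_of (beta X) Z" "K \<subseteq> Z" "disjnt Z (?e ` A)"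
      using zero_set_separating_compact_Lindelof[OF _ Hausdorff_space_beta K(1)] by blast
    have "K \<subseteq> beta X closure_of (?e ` A)" using K(2) by blast
    with that zero_set_missing_space[OF _ this Z]
    show "\<exists>Z. zero_set_of (beta X) Z \<and> K \<subseteq> Z \<and> Z \<subseteq> topspace (beta X) - ?e ` topspace X"
      by metis
  qed
  moreover have "?three" if "?two"
  proof (intro allI impI)
    fix K assume "compactin (beta X) K \<and> K \<subseteq> beta X closure_of (?e ` A) - ?e ` A"
    from that[rule_format, OF this] obtain Z where "zero_set_of (beta X) Z" "K \<subseteq> Z"
        "Z \<subseteq> topspace (beta X) - ?e ` topspace X"
      by blast
    then show "\<exists>\<Z>. countable \<Z> \<and> (\<forall>Z\<in>\<Z>. zero_set_of (beta X) Z) \<and>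
              K \<subseteq> \<Union>\<Z> \<and> \<Union>\<Z> \<subseteq> topspace (beta X) - ?e ` topspace X"
      by (intro exI[of _ "{Z}"]) auto
  qed
  moreover have "?one" if three: "?three"
  proof
    note cover = three[rule_format, OF conjI]
    show "Lindelof_space (subtopology X A)"
      unfolding Lin using Lindelof_space_if_zero_set_covers[OF compact_space_beta eA eX cover] .
    show "C_embedded_in X A"
      using C_embedded_if_zero_set_covers[OF compact_space_beta Hausdorff_space_beta eA eX cover]
      by (rule C_embedded_in_if_homeomorphic_image[OF e A])
  qed
  ultimately show ?thesis by argo
qed

end
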